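(* Let $p$ be a prime and let $A,B$ be non-empty subsets of the field $\mathbb{F}_p$, with sumset $A+B=\{a+b: a\in A, b\in B\}$. Then either \[\lambda(A+B)\geq\min\{\lambda(A),\lambda(B)\},\] or \[|A+B|\geq |A|+|B|+\lambda(A+B).\]
   Context: For a finite non-empty subset $A$ of a field $F$, its characteristic polynomial is $\Pi_A(X)=\prod_{a\in A}(X-a)$. For $\lambda\in\{0,\dots,|A|\}$, $A$ is called $\lambda$-null if in $\Pi_A(X)$ the coefficients of $X^{|A|-1},\dots,X^{|A|-\lambda}$ all vanish. Define $\lambda(A)=\max\{\lambda\in\{0,\dots,|A|\}: A\text{ is }\lambda\text{-null}\}$. *)

theory Defs
  imports
    "Berlekamp_Zassenhaus.Finite_Field"
    "HOL-Library.Set_Algebras"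
begin

text \<open>
  For finite non-empty \<open>A\<close>. On the empty set the polynomial is \<open>1\<close>; on infinite sets the values
  below are meaningless.
\<close>

definition set_char_poly :: "'a::field set \<Rightarrow> 'a poly" where
  "set_char_poly A = (\<Prod>a\<in>A. [:- a, 1:])"

definition is_null :: "nat \<Rightarrow> 'a::field set \<Rightarrow> bool" where
  "is_null l A \<longleftrightarrow> l \<le> card A \<and> (\<forall>i\<in>{1..l}. coeff (set_char_poly A) (card A - i) = 0)"

definition max_null :: "'a::field set \<Rightarrow> nat" where
  "max_null A = Max {l \<in> {0..card A}. is_null l A}"

end

theory Submission
  imports Defs
begin

text \<open>
  Lagrange interpolation gives a linear functional on polynomials, supported on \<open>A\<close>, that
  extracts the coefficient of \<open>X\<^bsup>|A|-1\<^esup>\<close> in the remainder modulo the characteristic polynomial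
  of \<open>A\<close>. If \<open>A\<close> is \<open>l\<close>-null, it kills every \<open>X\<^sup>k\<close> with \<open>k < |A| + l\<close> and \<open>k \<noteq> |A| - 1\<close>.
  Let \<open>C = A + B\<close> have nullity \<open>l\<close> while \<open>A\<close> and \<open>B\<close> are \<open>(l + 1)\<close>-null, and suppose
  \<open>|C| < |A| + |B| + l\<close>. Apply the product of the two functionals to \<open>x\<^sup>i y\<^sup>j \<Pi>\<^sub>C(x + y)\<close>, which
  vanishes on \<open>A \<times> B\<close>, with \<open>i + j = |A| + |B| + l - 1 - |C|\<close>. The leading term of \<open>\<Pi>\<^sub>C\<close>
  contributes nothing because \<open>A\<close> and \<open>B\<close> are \<open>(l + 1)\<close>-null, the terms after the next nonzero
  one have too small a degree, and so that next coefficient times a binomial coefficient which is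
  nonzero modulo \<open>p\<close> is zero.
\<close>

lemma poly_set_char_poly:
  "poly (set_char_poly A) x = (\<Prod>a\<in>A. x - a)"
  by (simp add: set_char_poly_def poly_prod)

lemma degree_set_char_poly: "degree (set_char_poly A) = card A"
  unfolding set_char_poly_def by (subst degree_prod_eq_sum_degree) auto

lemma coeff_set_char_poly_card: "coeff (set_char_poly A) (card A) = 1"
proof -
  have "lead_coeff (set_char_poly A) = 1"
    unfolding set_char_poly_def by (simp add: lead_coeff_prod)
  then show ?thesis by (simp add: degree_set_char_poly)
qed

lemma is_null_max_null: "is_null (max_null A) A"
proof -
  have "max_null A \<in> {l \<in> {0..card A}. is_null l A}"
    unfolding max_null_def by (rule Max_in) (auto simp: is_null_def intro!: exI[of _ 0])
  then show ?thesis by simp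
qed

lemma is_null_le_max_null:
  assumes "is_null l A"
  shows "l \<le> max_null A"
  using assms unfolding max_null_def by (intro Max_ge) (auto simp: is_null_def)

lemma is_null_antimono:
  assumes "is_null l A" "k \<le> l"
  shows "is_null k A"
  using assms by (auto simp: is_null_def)

lemma coeff_max_null_nonzero:
  assumes "max_null A < card A"
  shows "coeff (set_char_poly A) (card A - Suc (max_null A)) \<noteq> 0"
proof
  assume "coeff (set_char_poly A) (card A - Suc (max_null A)) = 0"
  with assms is_null_max_null[of A] have "is_null (Suc (max_null A)) A"
    by (auto simp: is_null_def le_Suc_eq)
  from is_null_le_max_null[OF this] show False by simp
qed

text \<open>For finite \<open>A\<close> and \<open>a \<in> A\<close> this is the barycentric weight
  of Lagrange interpolation, the inverse of the derivative of \<Pi>_A at \<open>a\<close>.\<close>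

definition interp_weight :: "'a::field set \<Rightarrow> 'a \<Rightarrow> 'a" where
  "interp_weight A a = inverse (\<Prod>b\<in>A - {a}. a - b)"

text \<open>A polynomial of degree below |A| equals its Lagrange interpolant \<open>r\<close>. Each
  unnormalised basis polynomial \<open>L a\<close> is monic of degree |A| - 1, so the top
  coefficient of \<open>r\<close> is the weighted sum of the values.\<close>

lemma sum_interp_weight:
  assumes A: "finite A" "A \<noteq> {}" and q: "degree q < card A"
  shows "(\<Sum>a\<in>A. interp_weight A a * poly q a) = coeff q (card A - 1)"
proof -
  define L where "L a = set_char_poly (A - {a})" for a
  define r where "r = (\<Sum>a\<in>A. smult (interp_weight A a * poly q a) (L a))"
  have cardL: "card (A - {a}) = card A - 1" if "a \<in> A" for a
    using A that by simp
  have L: "poly (L a) b = (if b = a then inverse (interp_weight A a) else 0)"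
    if "a \<in> A" "b \<in> A" for a b
    using A that by (auto simp: L_def poly_set_char_poly interp_weight_def)
  have w: "interp_weight A a \<noteq> 0" if "a \<in> A" for a
    using A by (auto simp: interp_weight_def)
  have "degree r \<le> card A - 1"
    unfolding r_def
    by (intro degree_sum_le A order_trans[OF degree_smult_le])
       (simp add: L_def degree_set_char_poly cardL)
  moreover have "card A > 0" using A by (simp add: card_gt_0_iff)
  ultimately have dr: "degree r < card A" by simp
  have "poly r b = poly q b" if "b \<in> A" for b
  proof -
    have "poly r b = (\<Sum>a\<in>A. if a = b then poly q b else 0)"
      unfolding r_def poly_sum
      by (intro sum.cong) (use that w in \<open>auto simp: L\<close>)
    then show ?thesis using A that by simp
  qed
  then have "r = q" by (intro poly_eqI_degree[of A] dr q) auto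
  moreover have "coeff r (card A - 1) = (\<Sum>a\<in>A. interp_weight A a * poly q a)"
    unfolding r_def coeff_sum
    by (intro sum.cong refl)
       (metis L_def cardL coeff_set_char_poly_card coeff_smult mult.right_neutral)
  ultimately show ?thesis by simp
qed

definition moment :: "'a::field set \<Rightarrow> nat \<Rightarrow> 'a" where
  "moment A k = (\<Sum>a\<in>A. interp_weight A a * a ^ k)"

lemma moment_below:
  assumes "finite A" "A \<noteq> {}" "k < card A"
  shows "moment A k = (if k = card A - 1 then 1 else 0)"
  using sum_interp_weight[OF assms(1,2), of "monom 1 k"] assms(3)
  by (simp add: moment_def poly_monom degree_monom_eq)

text \<open>Subtracting a multiple of \<Pi>_A from X^k keeps the values on \<open>A\<close>. Because
  of the gap below the leading term of \<Pi>_A, a single division step already leaves no coefficient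
  at index |A| - 1 or above.\<close>

lemma moment_null:
  assumes A: "finite A" "A \<noteq> {}" and null: "is_null l A"
    and k: "k < card A + l" "k \<noteq> card A - 1"
  shows "moment A k = 0"
proof (cases "k < card A")
  case True
  then show ?thesis using A k by (simp add: moment_below)
next
  case False
  define n where "n = card A"
  define q where "q = monom 1 k - monom 1 (k - n) * set_char_poly A"
  have n: "n > 0" "n \<le> k" using A False by (simp_all add: n_def card_gt_0_iff)
  have coeff_q: "coeff q m = 0" if "m \<ge> n - 1" for m
  proof -
    consider "m > k" | "m = k" | "m < k" by linarith
    then show ?thesis
    proof cases
      case 1
      then show ?thesis using n
        by (simp add: q_def coeff_monom_mult coeff_eq_0 degree_set_char_poly n_def)
    next
      case 2
      then show ?thesis using n coeff_set_char_poly_card[of A]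
        by (simp add: q_def coeff_monom_mult n_def)
    next
      case 3
      have "coeff (set_char_poly A) (n - (k - m)) = 0"
      proof -
        \<comment> \<open>From \<open>m \<ge> n - 1\<close> and \<open>k < n + l\<close>, the
          distance \<open>k - m\<close> stays within the gap.\<close>
        have "k - m \<in> {1..l}" using 3 that k n by (auto simp: n_def)
        then show ?thesis using null unfolding is_null_def n_def by blast
      qed
      moreover have "m - (k - n) = n - (k - m)" if "k - n \<le> m" using that 3 n by simp
      ultimately show ?thesis using 3 by (auto simp: q_def coeff_monom_mult)
    qed
  qed
  have "degree q \<le> n - 1" using coeff_q by (intro degree_le) auto
  then have "degree q < card A" using n by (simp add: n_def)
  from sum_interp_weight[OF A this] have "(\<Sum>a\<in>A. interp_weight A a * poly q a) = 0"
    using coeff_q[of "n - 1"] by (simp add: n_def)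
  moreover have "poly q a = a ^ k" if "a \<in> A" for a
    using A that by (auto simp: q_def poly_monom poly_set_char_poly)
  ultimately show ?thesis by (simp add: moment_def)
qed

text \<open>The product functional on x^i y^j (x + y)^k, expanded binomially so that it only
  involves moments of \<open>A\<close> and \<open>B\<close> separately.\<close>

definition sum_moment :: "'a::field set \<Rightarrow> 'a set \<Rightarrow> nat \<Rightarrow> nat \<Rightarrow> nat \<Rightarrow> 'a" where
  "sum_moment A B i j k =
    (\<Sum>s\<le>k. of_nat (k choose s) * moment A (i + s) * moment B (j + (k - s)))"

lemma sum_moment_eq:
  "sum_moment A B i j k =
    (\<Sum>a\<in>A. \<Sum>b\<in>B. interp_weight A a * interp_weight B b * a ^ i * b ^ j * (a + b) ^ k)"
proof -
  have "(\<Sum>a\<in>A. \<Sum>b\<in>B. interp_weight A a * interp_weight B b * a ^ i * b ^ j * (a + b) ^ k) =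
    (\<Sum>a\<in>A. \<Sum>b\<in>B. \<Sum>s\<le>k. of_nat (k choose s) * (interp_weight A a * a ^ (i + s)) *
      (interp_weight B b * b ^ (j + (k - s))))"
    unfolding power_add by (simp add: binomial_ring sum_distrib_left mult_ac)
  also have "\<dots> = (\<Sum>a\<in>A. \<Sum>s\<le>k. \<Sum>b\<in>B. of_nat (k choose s) *
      (interp_weight A a * a ^ (i + s)) * (interp_weight B b * b ^ (j + (k - s))))"
    by (intro sum.cong refl sum.swap)
  also have "\<dots> = (\<Sum>s\<le>k. \<Sum>a\<in>A. \<Sum>b\<in>B. of_nat (k choose s) *
      (interp_weight A a * a ^ (i + s)) * (interp_weight B b * b ^ (j + (k - s))))"
    by (rule sum.swap)
  also have "\<dots> = sum_moment A B i j k"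
    unfolding sum_moment_def moment_def
    by (simp add: sum_distrib_left sum_distrib_right mult_ac)
  finally show ?thesis ..
qed

lemma sum_moment_set_char_poly:
  assumes "finite A" "finite B"
  shows "(\<Sum>k\<le>card (A + B). coeff (set_char_poly (A + B)) k * sum_moment A B i j k) = 0"
proof -
  let ?P = "set_char_poly (A + B)"
  let ?w = "\<lambda>a b. interp_weight A a * interp_weight B b * a ^ i * b ^ j"
  have "(\<Sum>k\<le>card (A + B). coeff ?P k * sum_moment A B i j k) =
    (\<Sum>k\<le>card (A + B). \<Sum>a\<in>A. \<Sum>b\<in>B. ?w a b * (coeff ?P k * (a + b) ^ k))"
    by (simp add: sum_moment_eq sum_distrib_left mult_ac)
  also have "\<dots> = (\<Sum>a\<in>A. \<Sum>k\<le>card (A + B). \<Sum>b\<in>B. ?w a b * (coeff ?P k * (a + b) ^ k))"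
    by (rule sum.swap)
  also have "\<dots> = (\<Sum>a\<in>A. \<Sum>b\<in>B. \<Sum>k\<le>card (A + B). ?w a b * (coeff ?P k * (a + b) ^ k))"
    by (intro sum.cong refl sum.swap)
  also have "\<dots> = (\<Sum>a\<in>A. \<Sum>b\<in>B. ?w a b * poly ?P (a + b))"
    by (simp add: poly_altdef degree_set_char_poly sum_distrib_left)
  also have "\<dots> = 0"
  proof (intro sum.neutral ballI)
    fix a b assume "a \<in> A" "b \<in> B"
    then have "poly ?P (a + b) = 0"
      using assms by (auto simp: poly_set_char_poly finite_set_plus)
    then show "?w a b * poly ?P (a + b) = 0" by simp
  qed
  finally show ?thesis .
qed

text \<open>The two exponents add up to less than (|A| - 1) + (|B| - 1), so in each term one of them
  is below its critical value.\<close>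

lemma sum_moment_small:
  assumes A: "finite A" "A \<noteq> {}" and B: "finite B" "B \<noteq> {}"
    and "i + j + k + 2 < card A + card B"
  shows "sum_moment A B i j k = 0"
  unfolding sum_moment_def
proof (intro sum.neutral ballI)
  fix s assume s: "s \<in> {..k}"
  then have "i + s + 1 < card A \<or> j + (k - s) + 1 < card B" using assms(5) by auto
  then show "of_nat (k choose s) * moment A (i + s) * moment B (j + (k - s)) = 0"
    by (elim disjE) (simp_all add: moment_below A B)
qed

text \<open>Only the term with both exponents critical survives; the bounds on \<open>i\<close> and
  \<open>j\<close> place its index within 0..\<open>k\<close>.\<close>

lemma sum_moment_critical:
  assumes A: "finite A" "A \<noteq> {}" and B: "finite B" "B \<noteq> {}"
    and "i < card A" "j < card B" "i + j + k + 2 = card A + card B"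
  shows "sum_moment A B i j k = of_nat (k choose (card A - 1 - i))"
proof -
  have "sum_moment A B i j k = (\<Sum>s\<le>k. if s = card A - 1 - i then of_nat (k choose s) else 0)"
    unfolding sum_moment_def
  proof (intro sum.cong refl)
    fix s assume s: "s \<in> {..k}"
    consider "i + s + 1 < card A" | "j + (k - s) + 1 < card B"
      | "s = card A - 1 - i" "i + s = card A - 1" "j + (k - s) = card B - 1"
      using assms(5-) s by fastforce
    then show "of_nat (k choose s) * moment A (i + s) * moment B (j + (k - s)) =
      (if s = card A - 1 - i then of_nat (k choose s) else 0)"
      by cases (use A B s assms(5-) in \<open>auto simp: moment_below card_gt_0_iff\<close>)
  qed
  then show ?thesis using assms(5-) by simp
qed

text \<open>Either some exponent is below critical, or both are at most \<open>l\<close> above it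
  and not both critical. In each case one moment vanishes.\<close>

lemma sum_moment_null:
  assumes A: "finite A" "A \<noteq> {}" "is_null l A" and B: "finite B" "B \<noteq> {}" "is_null l B"
    and deg: "card A + card B < i + j + k + 2" "i + j + k + 2 \<le> card A + card B + l"
  shows "sum_moment A B i j k = 0"
  unfolding sum_moment_def
proof (intro sum.neutral ballI)
  fix s assume s: "s \<in> {..k}"
  have pos: "card A > 0" "card B > 0" using A B by (simp_all add: card_gt_0_iff)
  have "i + s < card A + l \<and> i + s \<noteq> card A - 1 \<or>
    j + (k - s) < card B + l \<and> j + (k - s) \<noteq> card B - 1"
    using s deg pos by auto
  then show "of_nat (k choose s) * moment A (i + s) * moment B (j + (k - s)) = 0"
    using moment_null[OF A(1-3)] moment_null[OF B(1-3)] by auto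
qed

lemma of_nat_binomial_mod_ring_nonzero:
  assumes "n < CARD('p::prime_card)" "k \<le> n"
  shows "(of_nat (n choose k) :: 'p mod_ring) \<noteq> 0"
proof
  assume "(of_nat (n choose k) :: 'p mod_ring) = 0"
  then have "CARD('p) dvd (n choose k)"
    by (simp add: of_nat_0_mod_ring_dvd)
  also have "(n choose k) dvd fact n"
    using assms(2) by (metis binomial_fact_lemma dvd_triv_right)
  finally show False
    using assms(1) prime_card[where 'a='p] by (simp add: prime_dvd_fact_iff)
qed

theorem theorem3p2:
  fixes A B :: "'p::prime_card mod_ring set"
  assumes "A \<noteq> {}" and "B \<noteq> {}"
  shows "max_null (A + B) \<ge> min (max_null A) (max_null B) \<or>
         card (A + B) \<ge> card A + card B + max_null (A + B)"
proof (rule ccontr)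
  define C where "C = A + B"
  define l where "l = max_null C"
  assume "\<not> ?thesis"
  then have lt: "l < max_null A" "l < max_null B" and small: "card C < card A + card B + l"
    by (auto simp: C_def l_def)
  have fin: "finite A" "finite B" "finite C" by simp_all
  have null: "is_null (Suc l) A" "is_null (Suc l) B"
    using lt by (auto intro: is_null_antimono[OF is_null_max_null])
  \<comment> \<open>A translate of \<open>A\<close> lies in \<open>C\<close>, so l < |A| \<le> |C|,
    and \<Pi>_C does have a coefficient just past its run of \<open>l\<close> zeros.\<close>
  obtain b where "b \<in> B" using assms by blast
  then have "(\<lambda>a. a + b) ` A \<subseteq> C" by (auto simp: C_def)
  then have "card A \<le> card C"
    by (metis card_image card_mono fin(3) inj_on_def add_right_cancel)
  moreover have "max_null A \<le> card A" using is_null_max_null[of A] by (simp add: is_null_def)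
  ultimately have "l < card C" using lt by simp
  \<comment> \<open>This gives \<open>m < p\<close> below, which keeps the binomial coefficient
    nonzero.\<close>
  have "card C \<le> CARD('p mod_ring)" by (intro card_mono) auto
  then have C_le: "card C \<le> CARD('p)" by simp
  define m where "m = card C - Suc l"
  have m: "card C = m + Suc l" using \<open>l < card C\<close> by (simp add: m_def)
  \<comment> \<open>Split \<open>m\<close> greedily into (|A| - 1 - i) + (|B| - 1 - j), making the
    term of index \<open>m\<close> critical. The assumed bound on |C| gives m \<le> |A| + |B| - 2,
    so the remainder fits into |B| - 1.\<close>
  define i where "i = card A - 1 - min m (card A - 1)"
  define j where "j = card B - 1 - (m - min m (card A - 1))"
  have pos: "card A > 0" "card B > 0" using assms by (simp_all add: card_gt_0_iff)
  have ij: "i < card A" "j < card B" "i + j + m + 2 = card A + card B"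
    using pos small m by (auto simp: i_def j_def min_def)
  have "0 = (\<Sum>k\<le>card C. coeff (set_char_poly C) k * sum_moment A B i j k)"
    using sum_moment_set_char_poly[OF fin(1,2)] by (simp add: C_def)
  also have "\<dots> = (\<Sum>k\<in>{m}. coeff (set_char_poly C) k * sum_moment A B i j k)"
  proof (intro sum.mono_neutral_right ballI)
    fix k assume k: "k \<in> {..card C} - {m}"
    consider "k < m" | "m < k" "k < card C" | "k = card C"
      using k by fastforce
    then show "coeff (set_char_poly C) k * sum_moment A B i j k = 0"
    proof cases
      case 1
      then show ?thesis using ij assms by (simp add: sum_moment_small)
    next
      case 2
      then have "card C - k \<in> {1..l}" "card C - (card C - k) = k" using m by auto
      then have "coeff (set_char_poly C) k = 0"
        using is_null_max_null[of C] unfolding is_null_def l_def by metis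
      then show ?thesis by simp
    next
      case 3
      \<comment> \<open>The leading term exceeds the critical degree by exactly
        \<open>l + 1\<close>, the most that the nullity of \<open>A\<close> and \<open>B\<close>
        covers.\<close>
      then have "sum_moment A B i j k = 0"
        using ij m assms null by (intro sum_moment_null[of A "Suc l" B]) auto
      then show ?thesis by simp
    qed
  qed (use m in auto)
  also have "\<dots> = coeff (set_char_poly C) m * of_nat (m choose (card A - 1 - i))"
    using ij assms by (simp add: sum_moment_critical)
  finally have "coeff (set_char_poly C) m * of_nat (m choose (card A - 1 - i)) = 0" by simp
  moreover have "coeff (set_char_poly C) m \<noteq> 0"
    using coeff_max_null_nonzero[of C] \<open>l < card C\<close> by (simp add: m_def l_def)
  moreover have "(of_nat (m choose (card A - 1 - i)) :: 'p mod_ring) \<noteq> 0"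
    using m C_le ij by (intro of_nat_binomial_mod_ring_nonzero) auto
  ultimately show False by simp
qed

end
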